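(* Let $A,B,C$ be three independent random $3$-sided dice drawn from the balanced uniform model. Then the probability that $A,B,C$ form an intransitive triple is $\frac{307}{1280}=0.23984375$, and the probability that they form a transitive chain is $\frac{973}{1280}=0.76015625$.
   Context: A random $3$-sided die in the balanced uniform model is a point $(a_1,a_2,a_3)\in[0,1]^3$ chosen uniformly conditioned on $a_1+a_2+a_3=3/2$; that is, it is distributed according to normalized two-dimensional area measure on the planar region $\{(a_1,a_2,a_3)\in[0,1]^3 : a_1+a_2+a_3=3/2\}$ (equivalently, $(a_1,a_2)$ is uniform on the projection of this region to the first two coordinates). For dice $A=(a_1,a_2,a_3)$ and $B=(b_1,b_2,b_3)$, $A$ dominates $B$, written $A\succ B$, if $\sum_{i,j=1}^{3}\operatorname{sgn}(a_i-b_j)>0$, where $\operatorname{sgn}$ takes the values $-1,0,1$. The dice $A,B,C$ form an intransitive triple if $A\succ B\succ C\succ A$ or $A\succ C\succ B\succ A$. They form a transitive chain if for some ordering $X,Y,Z$ of the three dice, $X\succ Y$, $Y\succ Z$ and $X\succ Z$. *)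

theory Defs
  imports "HOL-Probability.Probability" "HOL-Library.Multiset"
begin

definition balanced_region :: "(real ^ 3) set" where
  "balanced_region = {a. (\<forall>i. 0 \<le> a $ i \<and> a $ i \<le> 1) \<and> (\<Sum>i\<in>UNIV. a $ i) = 3 / 2}"

text \<open>
  The projection to the first two coordinates is injective on the plane of
  coordinate sum 3/2, with affine inverse, so it multiplies area by a constant
  factor. Normalized area measure on the region is therefore the image, under
  that inverse, of the uniform distribution on the projected region.
\<close>

definition balanced_die :: "(real ^ 3) measure" where
  "balanced_die =
     distr (uniform_measure lborel ((\<lambda>a. (a $ 1, a $ 2)) ` balanced_region)) borel
       (\<lambda>(x, y). vector [x, y, 3 / 2 - x - y])"

definition dominates :: "real ^ 3 \<Rightarrow> real ^ 3 \<Rightarrow> bool" (infix "\<succ>" 50) where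
  "a \<succ> b \<longleftrightarrow> (\<Sum>i\<in>UNIV. \<Sum>j\<in>UNIV. sgn (a $ i - b $ j)) > 0"

definition intransitive_triple :: "real ^ 3 \<Rightarrow> real ^ 3 \<Rightarrow> real ^ 3 \<Rightarrow> bool" where
  "intransitive_triple a b c \<longleftrightarrow>
     (a \<succ> b \<and> b \<succ> c \<and> c \<succ> a) \<or> (a \<succ> c \<and> c \<succ> b \<and> b \<succ> a)"

definition transitive_chain :: "real ^ 3 \<Rightarrow> real ^ 3 \<Rightarrow> real ^ 3 \<Rightarrow> bool" where
  "transitive_chain a b c \<longleftrightarrow>
     (\<exists>x y z. mset [x, y, z] = mset [a, b, c] \<and> x \<succ> y \<and> y \<succ> z \<and> x \<succ> z)"

end

theory Submission imports Defs begin

text \<open>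
  Almost surely no two faces of different dice are equal, and then the sum of the nine
  signs is odd, so that there is no draw. Three dice therefore form a tournament on three vertices
  (dominates_total). Such a tournament is either a 3-cycle or transitive, and it
  is transitive exactly if some vertex beats both others; that vertex is unique. With
  p(a) the probability that a random die is beaten by a, the probability of a transitive
  chain is thus three times the second moment of p(A), and the whole statement follows
  from the value 973/3840 of that moment.

  What makes p computable is the shape of domination on sorted dice
  a1 \<le> a2 \<le> a3 and b1 \<le> b2 \<le> b3. The differences ai - bi add up to 0, and if none of
  them vanishes, then a dominates b if and only if exactly two of them are positive,
  that is, if their product is negative (dominates_sorted_iff). In the
  parameters s = 1 - 2 a1 and t = 2 a3 - 1 the sorted dice form a kite in the unit
  square, and by the symmetry of the model a random die, sorted, is uniform on that
  kite (nn_integral_balanced_die). The dice beaten by a given one fill three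
  alternate sectors at a point of the kite, so p is a sum of three areas, which is
  piecewise quadratic (emeasure_beaten). Finally
  nn_integral_win_prob_squared integrates its square over the kite; the
  substitution x \<mapsto> 1 - x on all faces reduces this to half of the kite and three
  polynomial pieces.
\<close>

section \<open>Integration in the plane\<close>

lemma borel_measurable_vec_nth [measurable (raw)]:
  fixes f :: "'a \<Rightarrow> real ^ 'n"
  assumes "f \<in> borel_measurable M"
  shows "(\<lambda>x. f x $ i) \<in> borel_measurable M"
  using borel_measurable_inner[OF assms, of "\<lambda>_. axis i 1"] by (simp add: inner_axis)

lemma borel_measurable_vector_3 [measurable (raw)]:
  fixes f g h :: "'a \<Rightarrow> real"
  assumes [measurable]: "f \<in> borel_measurable M" "g \<in> borel_measurable M" "h \<in> borel_measurable M"
  shows "(\<lambda>x. vector [f x, g x, h x] :: real ^ 3) \<in> borel_measurable M"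
proof -
  have "(\<lambda>x. vector [f x, g x, h x] :: real ^ 3) =
      (\<lambda>x. f x *\<^sub>R axis 1 1 + g x *\<^sub>R axis 2 1 + h x *\<^sub>R axis 3 1)"
    by (simp add: fun_eq_iff vec_eq_iff forall_3 axis_def)
  then show ?thesis by simp
qed

lemma nn_integral_lborel_pair:
  fixes f :: "real \<times> real \<Rightarrow> ennreal"
  assumes "f \<in> borel_measurable borel"
  shows "(\<integral>\<^sup>+z. f z \<partial>lborel) = (\<integral>\<^sup>+x. \<integral>\<^sup>+y. f (x, y) \<partial>lborel \<partial>lborel)"
    and "(\<integral>\<^sup>+z. f z \<partial>lborel) = (\<integral>\<^sup>+y. \<integral>\<^sup>+x. f (x, y) \<partial>lborel \<partial>lborel)"
proof -
  have f: "f \<in> borel_measurable (lborel \<Otimes>\<^sub>M lborel)"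
    using assms by (simp add: lborel_prod)
  show "(\<integral>\<^sup>+z. f z \<partial>lborel) = (\<integral>\<^sup>+x. \<integral>\<^sup>+y. f (x, y) \<partial>lborel \<partial>lborel)"
    using lborel.nn_integral_fst[OF f] by (simp add: lborel_prod)
  show "(\<integral>\<^sup>+z. f z \<partial>lborel) = (\<integral>\<^sup>+y. \<integral>\<^sup>+x. f (x, y) \<partial>lborel \<partial>lborel)"
    using lborel_pair.nn_integral_snd[OF f] by (simp add: lborel_prod)
qed

lemma measurable_fst_snd_borel [measurable]:
  "fst \<in> borel_measurable (borel :: (real \<times> real) measure)"
  "snd \<in> borel_measurable (borel :: (real \<times> real) measure)"
  by (simp_all flip: borel_prod)

lemma sets_borel_Collect_pair:
  fixes P :: "real \<Rightarrow> real \<Rightarrow> bool"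
  assumes "Measurable.pred borel (\<lambda>z. P (fst z) (snd z))"
  shows "{(x, y). P x y} \<in> sets borel"
  using assms by (simp add: pred_def case_prod_unfold)

lemma nn_integral_lborel_swap:
  fixes f :: "real \<times> real \<Rightarrow> ennreal"
  assumes [measurable]: "f \<in> borel_measurable borel"
  shows "(\<integral>\<^sup>+(x, y). f (y, x) \<partial>lborel) = (\<integral>\<^sup>+z. f z \<partial>lborel)"
  by (subst nn_integral_lborel_pair(1)) (simp_all add: split_beta' nn_integral_lborel_pair(2))

section \<open>Symmetric functions on a plane of constant coordinate sum\<close>

text \<open>
  These two transpositions of the coordinates generate all permutations, so
  Lebesgue measure in the first two coordinates is a symmetric measure on the
  plane: exchanging x and y is Fubini, and exchanging y with the dependent
  coordinate is a reflection of the line for each fixed x.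
\<close>

lemma nn_integral_plane_swap:
  fixes h :: "real ^ 3 \<Rightarrow> ennreal"
  assumes [measurable]: "h \<in> borel_measurable borel"
  shows "(\<integral>\<^sup>+(x, y). h (vector [x, y, c - x - y]) \<partial>lborel) =
           (\<integral>\<^sup>+(x, y). h (vector [y, x, c - x - y]) \<partial>lborel)"
    and "(\<integral>\<^sup>+(x, y). h (vector [x, y, c - x - y]) \<partial>lborel) =
           (\<integral>\<^sup>+(x, y). h (vector [x, c - x - y, y]) \<partial>lborel)"
proof -
  have m: "(\<lambda>(x, y). h (vector [x, y, c - x - y])) \<in> borel_measurable borel"
    "(\<lambda>(x, y). h (vector [y, x, c - x - y])) \<in> borel_measurable borel"
    "(\<lambda>(x, y). h (vector [x, c - x - y, y])) \<in> borel_measurable borel"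
    by (simp_all flip: borel_prod)
  show "(\<integral>\<^sup>+(x, y). h (vector [x, y, c - x - y]) \<partial>lborel) =
           (\<integral>\<^sup>+(x, y). h (vector [y, x, c - x - y]) \<partial>lborel)"
    unfolding nn_integral_lborel_pair(1)[OF m(1)] nn_integral_lborel_pair(2)[OF m(2)]
    by (simp add: algebra_simps)
  have "(\<integral>\<^sup>+y. h (vector [x, y, c - x - y]) \<partial>lborel) =
      (\<integral>\<^sup>+y. h (vector [x, c - x - y, y]) \<partial>lborel)" for x
    by (subst nn_integral_real_affine[where c = "-1" and t = "c - x"]) simp_all
  then show "(\<integral>\<^sup>+(x, y). h (vector [x, y, c - x - y]) \<partial>lborel) =
           (\<integral>\<^sup>+(x, y). h (vector [x, c - x - y, y]) \<partial>lborel)"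
    unfolding nn_integral_lborel_pair(1)[OF m(1)] nn_integral_lborel_pair(1)[OF m(3)]
    by simp
qed

lemma AE_lborel_pairI:
  fixes P :: "real \<Rightarrow> real \<Rightarrow> bool"
  assumes "Measurable.pred borel (\<lambda>(x, y). P x y)" and "\<And>x. AE y in lborel. P x y"
  shows "AE (x, y) in lborel. P x y"
proof -
  have "{z \<in> space (lborel \<Otimes>\<^sub>M lborel). case z of (x, y) \<Rightarrow> P x y} \<in> sets (lborel \<Otimes>\<^sub>M lborel)"
    using assms(1) by (simp add: pred_def space_pair_measure flip: borel_prod)
  from lborel_pair.AE_pair_measure[OF this] assms(2) show ?thesis
    unfolding lborel_prod by simp
qed

lemma AE_lborel_pairI2:
  fixes P :: "real \<Rightarrow> real \<Rightarrow> bool"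
  assumes "Measurable.pred borel (\<lambda>(x, y). P x y)" and "\<And>y. AE x in lborel. P x y"
  shows "AE (x, y) in lborel. P x y"
proof -
  have "{z \<in> space (lborel \<Otimes>\<^sub>M lborel). P (fst z) (snd z)} \<in> sets (lborel \<Otimes>\<^sub>M lborel)"
    using assms(1) by (simp add: pred_def case_prod_beta space_pair_measure flip: borel_prod)
  from lborel_pair.AE_commute[OF this] assms(2) lborel_pair.AE_pair_iff[OF this] show ?thesis
    unfolding lborel_prod by (simp add: case_prod_beta)
qed

text \<open>
  Every coincidence that has to be discarded below (ties between faces, overlaps of
  adjacent regions) takes place on a line in the plane of parameters.
\<close>

lemma AE_lborel_off_line:
  fixes \<alpha> \<beta> \<gamma> :: real
  assumes "\<alpha> \<noteq> 0 \<or> \<beta> \<noteq> 0"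
  shows "AE (x, y) in lborel. \<alpha> * x + \<beta> * y \<noteq> \<gamma>"
proof (cases "\<beta> = 0")
  case False
  have "\<alpha> * x + \<beta> * y \<noteq> \<gamma>" if "y \<noteq> (\<gamma> - \<alpha> * x) / \<beta>" for x y
    using that False by (simp add: field_simps)
  then have "AE y in lborel. \<alpha> * x + \<beta> * y \<noteq> \<gamma>" for x
    using AE_lborel_singleton[of "(\<gamma> - \<alpha> * x) / \<beta>"] by (auto elim: eventually_mono)
  then show ?thesis
    by (intro AE_lborel_pairI) (simp_all flip: borel_prod)
next
  case True
  then have "\<alpha> * x + \<beta> * y \<noteq> \<gamma>" if "x \<noteq> \<gamma> / \<alpha>" for x y
    using that assms by (simp add: field_simps)
  then have "AE x in lborel. \<alpha> * x + \<beta> * y \<noteq> \<gamma>" for y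
    using AE_lborel_singleton[of "\<gamma> / \<alpha>"] by (auto elim: eventually_mono)
  then show ?thesis
    by (intro AE_lborel_pairI2) (simp_all flip: borel_prod)
qed

text \<open>
  Off the three null lines where two coordinates agree, a point of the plane lies
  in exactly one of six congruent chambers, one for each order of its coordinates.
  The chamber kept is written in terms of the smallest coordinate x and the
  largest coordinate y.
\<close>

lemma nn_integral_plane_symmetric:
  fixes f :: "real ^ 3 \<Rightarrow> ennreal"
  assumes [measurable]: "f \<in> borel_measurable borel"
    and s12: "\<And>x y z. f (vector [y, x, z]) = f (vector [x, y, z])"
    and s23: "\<And>x y z. f (vector [x, z, y]) = f (vector [x, y, z])"
  shows "(\<integral>\<^sup>+(x, y). f (vector [x, y, c - x - y]) \<partial>lborel) =
     6 * (\<integral>\<^sup>+(x, y). f (vector [x, c - x - y, y]) * indicator {(u, v). u \<le> c - u - v \<and> c - u - v \<le> v} (x, y) \<partial>lborel)"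
proof -
  \<comment> \<open>The part of f on one chamber; J w is its integral after the rearrangement w of the coordinates.\<close>
  define h where "h a = f a * indicator {a. a $ 1 \<le> a $ 2 \<and> a $ 2 \<le> a $ 3} a" for a :: "real ^ 3"
  have [measurable]: "h \<in> borel_measurable borel"
    unfolding h_def by measurable
  define J where "J w = (\<integral>\<^sup>+(x, y). h (w x y (c - x - y)) \<partial>lborel)"
    for w :: "real \<Rightarrow> real \<Rightarrow> real \<Rightarrow> real ^ 3"
  have J12: "J (\<lambda>x y z. w (vector [x, y, z])) = J (\<lambda>x y z. w (vector [y, x, z]))"
    if [measurable]: "w \<in> borel_measurable borel" for w :: "real ^ 3 \<Rightarrow> real ^ 3"
    unfolding J_def by (rule nn_integral_plane_swap(1)[of "\<lambda>a. h (w a)"]) measurable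
  have J23: "J (\<lambda>x y z. w (vector [x, y, z])) = J (\<lambda>x y z. w (vector [x, z, y]))"
    if [measurable]: "w \<in> borel_measurable borel" for w :: "real ^ 3 \<Rightarrow> real ^ 3"
    unfolding J_def by (rule nn_integral_plane_swap(2)[of "\<lambda>a. h (w a)"]) measurable
  let ?J = "J (\<lambda>x y z. vector [x, y, z])"
  have 1: "J (\<lambda>x y z. vector [y, x, z]) = ?J"
    using J12[of "\<lambda>a. a"] by simp
  have 2: "J (\<lambda>x y z. vector [x, z, y]) = ?J"
    using J23[of "\<lambda>a. a"] by simp
  have 3: "J (\<lambda>x y z. vector [z, x, y]) = ?J"
    using J23[of "\<lambda>a. vector [a $ 2, a $ 1, a $ 3]"] 1 by simp
  have 4: "J (\<lambda>x y z. vector [y, z, x]) = ?J"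
    using J12[of "\<lambda>a. vector [a $ 1, a $ 3, a $ 2]"] 2 by simp
  have 5: "J (\<lambda>x y z. vector [z, y, x]) = ?J"
    using J23[of "\<lambda>a. vector [a $ 2, a $ 3, a $ 1]"] 4 by simp
  have m [measurable]: "(\<lambda>z. h (vector [\<alpha> z, \<beta> z, \<gamma> z])) \<in> borel_measurable borel"
    if [measurable]: "\<alpha> \<in> borel_measurable borel" "\<beta> \<in> borel_measurable borel" "\<gamma> \<in> borel_measurable borel"
    for \<alpha> \<beta> \<gamma> :: "real \<times> real \<Rightarrow> real"
    by measurable
  have "(\<integral>\<^sup>+(x, y). f (vector [x, y, c - x - y]) \<partial>lborel) =
     (\<integral>\<^sup>+p. (case p of (x, y) \<Rightarrow> h (vector [x, y, c - x - y])) + (case p of (x, y) \<Rightarrow> h (vector [y, x, c - x - y]))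
       + (case p of (x, y) \<Rightarrow> h (vector [x, c - x - y, y])) + (case p of (x, y) \<Rightarrow> h (vector [c - x - y, x, y]))
       + (case p of (x, y) \<Rightarrow> h (vector [y, c - x - y, x])) + (case p of (x, y) \<Rightarrow> h (vector [c - x - y, y, x])) \<partial>lborel)"
  proof (intro nn_integral_cong_AE)
    have sym: "f (vector [y, x, z]) = f (vector [x, y, z])" "f (vector [x, z, y]) = f (vector [x, y, z])"
      "f (vector [z, x, y]) = f (vector [x, y, z])" "f (vector [y, z, x]) = f (vector [x, y, z])"
      "f (vector [z, y, x]) = f (vector [x, y, z])" for x y z
      by (metis s12 s23)+
    have "f (vector [x, y, z]) = h (vector [x, y, z]) + h (vector [y, x, z]) + h (vector [x, z, y])
        + h (vector [z, x, y]) + h (vector [y, z, x]) + h (vector [z, y, x])"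
      if "x \<noteq> y" "y \<noteq> z" "x \<noteq> z" for x y z
      using that sym[of x y z] unfolding h_def
      by (auto simp: indicator_def not_le)
    moreover have "AE (x, y) in lborel. x \<noteq> (y::real)"
      using AE_lborel_off_line[of 1 "-1" 0] by (simp add: case_prod_beta)
    moreover have "AE (x, y) in lborel. y \<noteq> c - x - y"
      using AE_lborel_off_line[of 1 2 c] by (rule eventually_mono) (auto simp: field_simps)
    moreover have "AE (x, y) in lborel. x \<noteq> c - x - y"
      using AE_lborel_off_line[of 2 1 c] by (rule eventually_mono) (auto simp: field_simps)
    ultimately show "AE p in lborel. (case p of (x, y) \<Rightarrow> f (vector [x, y, c - x - y])) =
      (case p of (x, y) \<Rightarrow> h (vector [x, y, c - x - y])) + (case p of (x, y) \<Rightarrow> h (vector [y, x, c - x - y]))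
       + (case p of (x, y) \<Rightarrow> h (vector [x, c - x - y, y])) + (case p of (x, y) \<Rightarrow> h (vector [c - x - y, x, y]))
       + (case p of (x, y) \<Rightarrow> h (vector [y, c - x - y, x])) + (case p of (x, y) \<Rightarrow> h (vector [c - x - y, y, x]))"
      by (auto elim!: eventually_elim2)
  qed
  also have "\<dots> = J (\<lambda>x y z. vector [x, y, z]) + J (\<lambda>x y z. vector [y, x, z]) + J (\<lambda>x y z. vector [x, z, y])
      + J (\<lambda>x y z. vector [z, x, y]) + J (\<lambda>x y z. vector [y, z, x]) + J (\<lambda>x y z. vector [z, y, x])"
    unfolding J_def by (simp add: nn_integral_add split_beta')
  also have "\<dots> = 6 * J (\<lambda>x y z. vector [x, z, y])"
  proof -
    have "a + a + a + a + a + a = (1 + 1 + 1 + 1 + 1 + 1) * a" for a :: ennreal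
      by (simp only: distrib_right mult_1_left)
    then show ?thesis
      unfolding 1 2 3 4 5 by simp
  qed
  finally show ?thesis
    by (simp add: J_def h_def case_prod_beta indicator_def)
qed

section \<open>The kite of sorted balanced dice\<close>

text \<open>
  The coordinates are s = 1 - 2 min and t = 2 max - 1, which turns the set of sorted
  balanced dice into a subset of the unit square. The last two inequalities say
  that the middle face lies between the other two.
\<close>

definition kite :: "(real \<times> real) set" where
  "kite = {(s, t). s \<le> 1 \<and> t \<le> 1 \<and> t \<le> 2 * s \<and> s \<le> 2 * t}"

definition kite_die :: "real \<Rightarrow> real \<Rightarrow> real ^ 3" where
  "kite_die s t = vector [(1 - s) / 2, (1 + s - t) / 2, (1 + t) / 2]"

lemma kite_measurable [measurable]: "kite \<in> sets borel"
  unfolding kite_def by (intro sets_borel_Collect_pair) measurable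

lemma kite_die_measurable [measurable (raw)]:
  assumes [measurable]: "f \<in> borel_measurable M" "g \<in> borel_measurable M"
  shows "(\<lambda>x. kite_die (f x) (g x)) \<in> borel_measurable M"
  unfolding kite_die_def by measurable

text \<open>
  The areas below change their formula where a line through a given point leaves the
  kite through another side. All these changes are of this C1 form, so one
  antiderivative serves on both sides of each break.
\<close>

definition pos_sq :: "real \<Rightarrow> real" where
  "pos_sq x = (max 0 x)\<^sup>2"

lemma pos_sq_simps:
  "x \<le> 0 \<Longrightarrow> pos_sq x = 0"
  "0 \<le> x \<Longrightarrow> pos_sq x = x\<^sup>2"
  by (simp_all add: pos_sq_def)

lemma DERIV_pos_sq [derivative_intros]:
  fixes g :: "real \<Rightarrow> real"
  assumes "(g has_real_derivative g') (at x)"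
  shows "((\<lambda>x. pos_sq (g x)) has_real_derivative 2 * max 0 (g x) * g') (at x)"
proof -
  have "((\<lambda>y. (max 0 y)\<^sup>2) has_real_derivative 2 * max 0 y) (at y)" for y :: real
  proof -
    consider "y < 0" | "y = 0" | "y > 0" by linarith
    then show ?thesis
    proof cases
      case 1
      have "\<forall>\<^sub>F z in nhds y. 0 = (max 0 z)\<^sup>2"
        using eventually_nhds_in_open[of "{..<0}" y] 1
        by (auto elim!: eventually_mono simp: max_def)
      then show ?thesis
        using 1 DERIV_cong_ev[of y y "\<lambda>_. 0" "\<lambda>z. (max 0 z)\<^sup>2" 0 0] by simp
    next
      case 2
      have "((\<lambda>h. (max 0 h)\<^sup>2 / h) \<longlongrightarrow> 0) (at (0::real))"
      proof (rule Lim_null_comparison)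
        show "\<forall>\<^sub>F h in at (0::real). norm ((max 0 h)\<^sup>2 / h) \<le> \<bar>h\<bar>"
          by (intro always_eventually) (auto simp: max_def power2_eq_square)
        show "((\<lambda>h. \<bar>h\<bar>) \<longlongrightarrow> 0) (at (0::real))"
          by (intro tendsto_eq_intros) auto
      qed
      then show ?thesis
        using 2 by (simp add: DERIV_def)
    next
      case 3
      have "\<forall>\<^sub>F z in nhds y. z\<^sup>2 = (max 0 z)\<^sup>2"
        using eventually_nhds_in_open[of "{0<..}" y] 3
        by (auto elim!: eventually_mono simp: max_def)
      moreover have "((\<lambda>z. z\<^sup>2) has_real_derivative 2 * max 0 y) (at y)"
        using 3 by (auto intro!: derivative_eq_intros)
      ultimately show ?thesis
        using DERIV_cong_ev[of y y "\<lambda>z. z\<^sup>2" "\<lambda>z. (max 0 z)\<^sup>2" "2 * max 0 y" "2 * max 0 y"] by simp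
    qed
  qed
  from DERIV_chain2[OF this assms] show ?thesis
    by (simp add: pos_sq_def)
qed

text \<open>
  Slices on which the lower graph lies above the upper one are empty, whence the
  truncation at 0. That v is nonnegative is recorded because the areas are later
  added as extended nonnegative reals.
\<close>

lemma area_between_graphs:
  fixes \<alpha> \<beta> f F :: "real \<Rightarrow> real"
  assumes [measurable]: "\<alpha> \<in> borel_measurable borel" "\<beta> \<in> borel_measurable borel" "f \<in> borel_measurable borel"
    and A: "\<And>x y. (x, y) \<in> A \<longleftrightarrow> x \<in> {a..b} \<and> \<alpha> x \<le> y \<and> y \<le> \<beta> x"
    and "a \<le> b"
    and F: "\<And>x. a \<le> x \<Longrightarrow> x \<le> b \<Longrightarrow> (F has_real_derivative f x) (at x)"
    and f: "\<And>x. a \<le> x \<Longrightarrow> x \<le> b \<Longrightarrow> f x = max 0 (\<beta> x - \<alpha> x)"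
    and v: "F b - F a = v"
  shows "emeasure lborel A = ennreal v \<and> 0 \<le> v"
proof -
  have "F a \<le> F b"
    using F f \<open>a \<le> b\<close> by (intro DERIV_nonneg_imp_nondecreasing[of a b F]) (auto intro!: exI)
  then have "0 \<le> v"
    using v by simp
  have "A = {(x, y). x \<in> {a..b} \<and> \<alpha> x \<le> y \<and> y \<le> \<beta> x}"
    using A by auto
  then have [measurable]: "A \<in> sets borel"
    by (simp only:) (intro sets_borel_Collect_pair, measurable)
  have "emeasure lborel A = (\<integral>\<^sup>+x. \<integral>\<^sup>+y. indicator A (x, y) \<partial>lborel \<partial>lborel)"
    using nn_integral_lborel_pair(1)[of "indicator A"] by simp
  also have "\<dots> = (\<integral>\<^sup>+x. ennreal (f x) * indicator {a..b} x \<partial>lborel)"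
  proof (intro nn_integral_cong)
    fix x :: real
    have "(\<integral>\<^sup>+y. indicator A (x, y) \<partial>lborel) =
        (\<integral>\<^sup>+y. indicator {\<alpha> x..\<beta> x} y * indicator {a..b} x \<partial>lborel)"
      by (intro nn_integral_cong) (auto simp: A indicator_def)
    also have "\<dots> = emeasure lborel {\<alpha> x..\<beta> x} * indicator {a..b} x"
      by (simp add: nn_integral_multc)
    also have "\<dots> = ennreal (f x) * indicator {a..b} x"
      using f[of x] by (auto simp: emeasure_lborel_Icc_eq indicator_def max_def)
    finally show "(\<integral>\<^sup>+y. indicator A (x, y) \<partial>lborel) = ennreal (f x) * indicator {a..b} x" .
  qed
  also have "\<dots> = ennreal v"
    using F f \<open>a \<le> b\<close> unfolding v[symmetric] by (intro nn_integral_FTC_Icc) auto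
  finally show ?thesis
    using \<open>0 \<le> v\<close> by simp
qed

lemma emeasure_kite: "emeasure lborel kite = ennreal (1 / 2)"
proof (rule area_between_graphs[where a = 0 and b = 1
        and \<alpha> = "\<lambda>s. s / 2" and \<beta> = "\<lambda>s. min 1 (2 * s)"
        and f = "\<lambda>s. 1 - 2 * max 0 (1 / 2 - s) - s / 2"
        and F = "\<lambda>s. s + pos_sq (1 / 2 - s) - s\<^sup>2 / 4", THEN conjunct1])
  show "1 + pos_sq (1 / 2 - 1) - 1\<^sup>2 / 4 - (0 + pos_sq (1 / 2 - 0) - 0\<^sup>2 / 4) = 1 / 2"
    by (simp add: pos_sq_simps power2_eq_square)
qed (auto intro!: derivative_eq_intros simp: kite_def max_def min_def)

text \<open>
  The constant is 3/2 = 6 / 4: six chambers, and the change from (min, max) to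
  (s, t) scales area by 4.
\<close>

lemma nn_integral_cube_slice:
  fixes f :: "real ^ 3 \<Rightarrow> ennreal"
  assumes [measurable]: "f \<in> borel_measurable borel"
    and "\<And>x y z. f (vector [y, x, z]) = f (vector [x, y, z])"
    and "\<And>x y z. f (vector [x, z, y]) = f (vector [x, y, z])"
  defines "cube \<equiv> {a :: real ^ 3. \<forall>i. 0 \<le> a $ i \<and> a $ i \<le> 1}"
  shows "(\<integral>\<^sup>+(x, y). f (vector [x, y, 3 / 2 - x - y]) * indicator cube (vector [x, y, 3 / 2 - x - y]) \<partial>lborel) =
     ennreal (3 / 2) * (\<integral>\<^sup>+(s, t). f (kite_die s t) * indicator kite (s, t) \<partial>lborel)"
proof -
  have [measurable]: "cube \<in> sets borel"
    unfolding cube_def forall_3 by measurable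
  define S where "S = {(u, v). u \<le> 3 / 2 - u - v \<and> 3 / 2 - u - v \<le> (v::real)}"
  have [measurable]: "S \<in> sets borel"
    unfolding S_def by (intro sets_borel_Collect_pair) measurable
  define h where "h u v = f (vector [u, 3 / 2 - u - v, v]) * indicator cube (vector [u, 3 / 2 - u - v, v]) * indicator S (u, v)" for u v
  have h [measurable]: "(\<lambda>x. h (\<alpha> x) (\<beta> x)) \<in> borel_measurable M"
    if [measurable]: "\<alpha> \<in> borel_measurable M" "\<beta> \<in> borel_measurable M" for \<alpha> \<beta> and M :: "'z measure"
  proof -
    have [measurable]: "(\<lambda>x. (\<alpha> x, \<beta> x)) \<in> borel_measurable M"
      by (simp flip: borel_prod)
    show ?thesis unfolding h_def by measurable
  qed
  have "(\<integral>\<^sup>+(x, y). f (vector [x, y, 3 / 2 - x - y]) * indicator cube (vector [x, y, 3 / 2 - x - y]) \<partial>lborel) =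
      6 * (\<integral>\<^sup>+(x, y). h x y \<partial>lborel)"
    unfolding h_def S_def
    by (rule nn_integral_plane_symmetric[of "\<lambda>a. f a * indicator cube a"])
      (auto simp: assms(2,3) cube_def forall_3 indicator_def)
  also have "(\<integral>\<^sup>+(x, y). h x y \<partial>lborel) = (\<integral>\<^sup>+u. \<integral>\<^sup>+v. h u v \<partial>lborel \<partial>lborel)"
    by (subst nn_integral_lborel_pair(1)) (simp_all add: split_beta')
  also have "\<dots> = (\<integral>\<^sup>+s. \<integral>\<^sup>+t. ennreal (1 / 4) * h ((1 - s) / 2) ((1 + t) / 2) \<partial>lborel \<partial>lborel)"
  proof -
    have "(\<integral>\<^sup>+u. \<integral>\<^sup>+v. h u v \<partial>lborel \<partial>lborel) =
        ennreal (1 / 2) * (\<integral>\<^sup>+s. \<integral>\<^sup>+v. h ((1 - s) / 2) v \<partial>lborel \<partial>lborel)"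
      by (subst nn_integral_real_affine[where c = "- 1 / 2" and t = "1 / 2"])
        (simp_all add: diff_divide_distrib)
    also have "\<dots> = ennreal (1 / 2) * (\<integral>\<^sup>+s. ennreal (1 / 2) * (\<integral>\<^sup>+t. h ((1 - s) / 2) ((1 + t) / 2) \<partial>lborel) \<partial>lborel)"
      by (subst (2) nn_integral_real_affine[where c = "1 / 2" and t = "1 / 2"])
        (simp_all add: add_divide_distrib)
    also have "\<dots> = (\<integral>\<^sup>+s. \<integral>\<^sup>+t. ennreal (1 / 4) * h ((1 - s) / 2) ((1 + t) / 2) \<partial>lborel \<partial>lborel)"
    proof -
      have "ennreal (1 / 2) * ennreal (1 / 2) = ennreal (1 / 4)"
        by (subst ennreal_mult[symmetric]) simp_all
      then show ?thesis
        by (simp add: nn_integral_cmult del: ennreal_half flip: mult.assoc)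
    qed
    finally show ?thesis .
  qed
  also have "\<dots> = (\<integral>\<^sup>+(s, t). ennreal (1 / 4) * h ((1 - s) / 2) ((1 + t) / 2) \<partial>lborel)"
    by (subst nn_integral_lborel_pair(1)) (simp_all add: split_beta')
  also have "\<dots> = (\<integral>\<^sup>+(s, t). ennreal (1 / 4) * (f (kite_die s t) * indicator kite (s, t)) \<partial>lborel)"
  proof (intro nn_integral_cong)
    fix z
    show "(case z of (s, t) \<Rightarrow> ennreal (1 / 4) * h ((1 - s) / 2) ((1 + t) / 2)) = 
      (case z of (s, t) \<Rightarrow> ennreal (1 / 4) * (f (kite_die s t) * indicator kite (s, t)))"
    proof (cases z)
      case (Pair s t)
      have 1: "3 / 2 - (1 - s) / 2 - (1 + t) / 2 = (1 + s - t) / 2"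
        by (simp add: field_simps)
      have 2: "indicator cube (kite_die s t) * indicator S ((1 - s) / 2, (1 + t) / 2) = (indicator kite (s, t) :: ennreal)"
        by (auto simp: cube_def forall_3 kite_die_def S_def kite_def indicator_def field_simps)
      show ?thesis
        unfolding Pair prod.case h_def 1 2[symmetric] kite_die_def by (simp only: mult.assoc)
    qed
  qed
  also have "\<dots> = ennreal (1 / 4) * (\<integral>\<^sup>+(s, t). f (kite_die s t) * indicator kite (s, t) \<partial>lborel)"
    by (simp add: nn_integral_cmult split_beta')
  also have "6 * (ennreal (1 / 4) * X) = ennreal (3 / 2) * X" for X
  proof -
    have "6 * ennreal (1 / 4) = ennreal (3 / 2)"
      by (simp flip: ennreal_numeral ennreal_mult)
    then show ?thesis by (simp flip: mult.assoc)
  qed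
  finally show ?thesis .
qed

text \<open>
  For permutation-invariant integrands a balanced die may be replaced by a sorted one
  with (s, t) uniform on the kite, which has area 1/2. With f = 1 the preceding
  lemma also gives the area 3/4 of the projected hexagon, by which the uniform
  distribution is normalized.
\<close>

lemma nn_integral_balanced_die:
  fixes f :: "real ^ 3 \<Rightarrow> ennreal"
  assumes [measurable]: "f \<in> borel_measurable borel"
    and "\<And>x y z. f (vector [y, x, z]) = f (vector [x, y, z])"
    and "\<And>x y z. f (vector [x, z, y]) = f (vector [x, y, z])"
  shows "(\<integral>\<^sup>+a. f a \<partial>balanced_die) = 2 * (\<integral>\<^sup>+(s, t). f (kite_die s t) * indicator kite (s, t) \<partial>lborel)"
proof -
  define cube where "cube = {a :: real ^ 3. \<forall>i. 0 \<le> a $ i \<and> a $ i \<le> 1}"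
  define H where "H = (\<lambda>a. (a $ 1, a $ 2)) ` balanced_region"
  have H: "(x, y) \<in> H \<longleftrightarrow> vector [x, y, 3 / 2 - x - y] \<in> cube" for x y
  proof
    assume "(x, y) \<in> H"
    then obtain a where a: "a \<in> balanced_region" "x = a $ 1" "y = a $ 2"
      by (auto simp: H_def)
    then have "a $ 3 = 3 / 2 - x - y"
      by (simp add: balanced_region_def sum_3)
    with a show "vector [x, y, 3 / 2 - x - y] \<in> cube"
      by (simp add: balanced_region_def cube_def forall_3)
  next
    assume "vector [x, y, 3 / 2 - x - y] \<in> cube"
    then have "vector [x, y, 3 / 2 - x - y] \<in> balanced_region"
      by (simp add: balanced_region_def cube_def sum_3)
    then show "(x, y) \<in> H"
      unfolding H_def by (rule rev_image_eqI) simp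
  qed
  have ind: "indicator H (x, y) = (indicator cube (vector [x, y, 3 / 2 - x - y]) :: ennreal)" for x y
    by (simp add: indicator_def H)
  have [measurable]: "H \<in> sets borel"
  proof -
    have "H = {(x, y). vector [x, y, 3 / 2 - x - y] \<in> cube}"
      using H by auto
    then show ?thesis
      by (simp only: cube_def forall_3 mem_Collect_eq) (intro sets_borel_Collect_pair, measurable)
  qed
  have "emeasure lborel H = (\<integral>\<^sup>+z. indicator H z \<partial>lborel)"
    by simp
  also have "\<dots> = (\<integral>\<^sup>+(x, y). 1 * indicator cube (vector [x, y, 3 / 2 - x - y]) \<partial>lborel)"
    by (intro nn_integral_cong) (auto simp: ind)
  also have "\<dots> = ennreal (3 / 2) * (\<integral>\<^sup>+(s, t). 1 * indicator kite (s, t) \<partial>lborel)"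
    unfolding cube_def by (rule nn_integral_cube_slice) simp_all
  also have "(\<integral>\<^sup>+(s, t). 1 * indicator kite (s, t) \<partial>lborel) = ennreal (1 / 2)"
    by (simp add: emeasure_kite case_prod_unfold)
  finally have eH: "emeasure lborel H = ennreal (3 / 4)"
    by (subst (asm) ennreal_mult[symmetric]) simp_all
  have [measurable]: "(\<lambda>(x, y). vector [x, y, 3 / 2 - x - y] :: real ^ 3) \<in> borel_measurable borel"
    by (simp add: split_beta')
  have "(\<integral>\<^sup>+a. f a \<partial>balanced_die) =
      (\<integral>\<^sup>+z. f (case z of (x, y) \<Rightarrow> vector [x, y, 3 / 2 - x - y]) \<partial>uniform_measure lborel H)"
    unfolding balanced_die_def H_def[symmetric] by (subst nn_integral_distr) simp_all
  also have "\<dots> = (\<integral>\<^sup>+z. f (case z of (x, y) \<Rightarrow> vector [x, y, 3 / 2 - x - y]) * indicator H z \<partial>lborel) / emeasure lborel H"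
    by (rule nn_integral_uniform_measure) simp_all
  also have "(\<integral>\<^sup>+z. f (case z of (x, y) \<Rightarrow> vector [x, y, 3 / 2 - x - y]) * indicator H z \<partial>lborel) =
      (\<integral>\<^sup>+(x, y). f (vector [x, y, 3 / 2 - x - y]) * indicator cube (vector [x, y, 3 / 2 - x - y]) \<partial>lborel)"
    by (intro nn_integral_cong) (auto simp: ind)
  also have "\<dots> = ennreal (3 / 2) * (\<integral>\<^sup>+(s, t). f (kite_die s t) * indicator kite (s, t) \<partial>lborel)"
    unfolding cube_def by (rule nn_integral_cube_slice) (simp_all add: assms)
  also have "\<dots> / emeasure lborel H = 2 * (\<integral>\<^sup>+(s, t). f (kite_die s t) * indicator kite (s, t) \<partial>lborel)"
  proof -
    have "ennreal (3 / 2) / ennreal (3 / 4) = 2"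
      by (simp add: divide_ennreal)
    moreover have "ennreal (3 / 2) * X / ennreal (3 / 4) = ennreal (3 / 2) / ennreal (3 / 4) * X" for X
      by (simp only: divide_ennreal_def mult_ac)
    ultimately show ?thesis
      unfolding eH by simp
  qed
  finally show ?thesis .
qed

section \<open>Domination between sorted dice\<close>

lemma dominates_asym: "a \<succ> b \<Longrightarrow> \<not> b \<succ> a"
proof -
  have "(\<Sum>i\<in>UNIV. \<Sum>j\<in>UNIV. sgn (b $ i - a $ j)) = - (\<Sum>i\<in>UNIV. \<Sum>j\<in>UNIV. sgn (a $ i - b $ j))"
    by (subst sum.swap) (simp add: sum_negf[symmetric] sgn_minus[symmetric] del: sum_negf)
  then show "a \<succ> b \<Longrightarrow> \<not> b \<succ> a"
    by (simp add: dominates_def)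
qed

text \<open>
  As the differences x1 - y1, x2 - y2, x3 - y3 add up to 0, a negative product means
  that two of them are positive and one is negative. In each of the three cases the
  order of the faces fixes at least eight of the nine comparisons, enough for a
  positive sum of signs.
\<close>

lemma dominates_sorted_aux:
  fixes x1 x2 x3 y1 y2 y3 :: real
  assumes "x1 \<le> x2" "x2 \<le> x3" "y1 \<le> y2" "y2 \<le> y3" "x1 + x2 + x3 = y1 + y2 + y3"
    and "(x1 - y1) * (x2 - y2) * (x3 - y3) < 0"
  shows "vector [x1, x2, x3] \<succ> vector [y1, y2, y3]"
proof -
  consider "x1 > y1" "x2 > y2" "x3 < y3" | "x1 > y1" "x2 < y2" "x3 > y3" | "x1 < y1" "x2 > y2" "x3 > y3"
    using assms(5,6) by (auto simp: mult_less_0_iff zero_less_mult_iff)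
  then show ?thesis
  proof cases
    case 1
    then have "sgn (x1 - y1) = 1" "sgn (x2 - y1) = 1" "sgn (x3 - y1) = 1" "sgn (x2 - y2) = 1" "sgn (x3 - y2) = 1"
      "sgn (x1 - y3) = - 1" "sgn (x2 - y3) = - 1" "sgn (x3 - y3) = - 1"
      using assms(1-4) by simp_all
    then show ?thesis
      by (simp add: dominates_def sum_3 sgn_if[of "x1 - y2"])
  next
    case 2
    then have "sgn (x1 - y1) = 1" "sgn (x2 - y1) = 1" "sgn (x3 - y1) = 1" "sgn (x3 - y2) = 1" "sgn (x3 - y3) = 1"
      "sgn (x1 - y2) = - 1" "sgn (x1 - y3) = - 1" "sgn (x2 - y2) = - 1" "sgn (x2 - y3) = - 1"
      using assms(1-4) by simp_all
    then show ?thesis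
      by (simp add: dominates_def sum_3)
  next
    case 3
    then have "sgn (x3 - y1) = 1" "sgn (x3 - y2) = 1" "sgn (x3 - y3) = 1" "sgn (x2 - y1) = 1" "sgn (x2 - y2) = 1"
      "sgn (x1 - y1) = - 1" "sgn (x1 - y2) = - 1" "sgn (x1 - y3) = - 1"
      using assms(1-4) by simp_all
    then show ?thesis
      by (simp add: dominates_def sum_3 sgn_if[of "x2 - y3"])
  qed
qed

text \<open>
  The key simplification: between sorted balanced dice without ties at equal rank,
  domination is the sign of a product of three linear forms. The converse of the
  previous lemma comes from exchanging the two dice, which changes the sign of the
  product.
\<close>

lemma dominates_sorted_iff:
  fixes x1 x2 x3 y1 y2 y3 :: real
  assumes "x1 \<le> x2" "x2 \<le> x3" "y1 \<le> y2" "y2 \<le> y3" "x1 + x2 + x3 = y1 + y2 + y3"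
    and "x1 \<noteq> y1" "x2 \<noteq> y2" "x3 \<noteq> y3"
  shows "vector [x1, x2, x3] \<succ> vector [y1, y2, y3] \<longleftrightarrow> (x1 - y1) * (x2 - y2) * (x3 - y3) < 0"
proof -
  have "(y1 - x1) * (y2 - x2) * (y3 - x3) = - ((x1 - y1) * (x2 - y2) * (x3 - y3))"
    by (simp add: algebra_simps)
  moreover have "(x1 - y1) * (x2 - y2) * (x3 - y3) \<noteq> 0"
    using assms(6-8) by simp
  ultimately show ?thesis
    using dominates_sorted_aux[of x1 x2 x3 y1 y2 y3] dominates_sorted_aux[of y1 y2 y3 x1 x2 x3]
      dominates_asym assms(1-5) by (metis neg_less_0_iff_less not_less_iff_gr_or_eq)
qed

text \<open>
  Three lines through (s, t) cut the kite into six sectors according to the signs of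
  the three linear forms. The beaten dice fill three alternate ones.
\<close>

lemma dominates_kite_die:
  assumes "(s, t) \<in> kite" "(s', t') \<in> kite" "s' \<noteq> s" "t' \<noteq> t" "s' - s \<noteq> t' - t"
  shows "kite_die s t \<succ> kite_die s' t' \<longleftrightarrow>
    s' > s \<and> t' - t > s' - s \<or> t' < t \<and> t' - t > s' - s \<or> s' > s \<and> t' < t"
proof -
  have "kite_die s t \<succ> kite_die s' t' \<longleftrightarrow>
      ((1 - s) / 2 - (1 - s') / 2) * ((1 + s - t) / 2 - (1 + s' - t') / 2) * ((1 + t) / 2 - (1 + t') / 2) < 0"
    unfolding kite_die_def using assms by (intro dominates_sorted_iff) (auto simp: kite_def field_simps)
  also have "((1 - s) / 2 - (1 - s') / 2) * ((1 + s - t) / 2 - (1 + s' - t') / 2) * ((1 + t) / 2 - (1 + t') / 2) =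
      - ((s' - s) * (t' - t) * ((t' - t) - (s' - s))) / 8"
    by (simp add: field_simps)
  also have "\<dots> < 0 \<longleftrightarrow> 0 < (s' - s) * (t' - t) * ((t' - t) - (s' - s))"
    by simp
  also have "\<dots> \<longleftrightarrow> s' > s \<and> t' - t > s' - s \<or> t' < t \<and> t' - t > s' - s \<or> s' > s \<and> t' < t"
    using assms(3-5) unfolding zero_less_mult_iff mult_less_0_iff by linarith
  finally show ?thesis .
qed

lemma dominates_permute_die:
  "vector [y, x, z] \<succ> b \<longleftrightarrow> vector [x, y, z] \<succ> b"
  "vector [x, z, y] \<succ> b \<longleftrightarrow> vector [x, y, z] \<succ> b"
  "a \<succ> vector [y, x, z] \<longleftrightarrow> a \<succ> vector [x, y, z]"
  "a \<succ> vector [x, z, y] \<longleftrightarrow> a \<succ> vector [x, y, z]"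
  by (simp_all add: dominates_def sum_3 algebra_simps)

lemma dominates_measurable [measurable (raw)]:
  assumes [measurable]: "f \<in> borel_measurable M" "g \<in> borel_measurable M"
  shows "Measurable.pred M (\<lambda>x. f x \<succ> g x)"
  unfolding dominates_def by measurable

section \<open>The probability of beating a random die\<close>

text \<open>
  For (s, t) in the kite this is twice the total area of the three sectors that it beats,
  that is, their share of the kite.
\<close>

definition win_prob :: "real \<Rightarrow> real \<Rightarrow> real" where
  "win_prob s t = 1 - 2 * t + 5 / 2 * s\<^sup>2 + 7 / 2 * t\<^sup>2 - 4 * s * t
     - 2 * pos_sq (1 / 2 - s) - 2 * pos_sq (t - 1 / 2) - 4 * pos_sq (s - t)"

lemma AE_kite_die_comparison:
  "AE (s', t') in lborel. s' \<noteq> s \<and> t' \<noteq> t \<and> s' - s \<noteq> t' - (t::real)"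
proof -
  have "AE z in lborel. fst (z :: real \<times> real) \<noteq> s"
    using AE_lborel_off_line[of 1 0 s] by (simp add: split_beta')
  moreover have "AE z in lborel. snd (z :: real \<times> real) \<noteq> t"
    using AE_lborel_off_line[of 0 1 t] by (simp add: split_beta')
  moreover have "AE z in lborel. fst (z :: real \<times> real) - s \<noteq> snd z - t"
    using AE_lborel_off_line[of 1 "-1" "s - t"] by (rule eventually_mono) auto
  ultimately show ?thesis
    by eventually_elim auto
qed

text \<open>
  R1, R2, R3 are the three sectors of beaten dice. R1 and R3 lie over s' \<ge> s and are
  measured by vertical slices; R2 lies over t' \<le> t and its horizontal slices are the
  simpler ones. The truncated terms in the slice lengths set in where a slice ends on
  another side of its region or becomes empty.
\<close>

lemma emeasure_beaten:
  assumes K: "(s, t) \<in> kite"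
  shows "emeasure balanced_die {b. kite_die s t \<succ> b} = ennreal (win_prob s t)"
    and "0 \<le> win_prob s t"
proof -
  have st: "s \<le> 1" "t \<le> 1" "t \<le> 2 * s" "s \<le> 2 * t" "0 \<le> t"
    using K by (auto simp: kite_def)
  define R1 where "R1 = kite \<inter> {(s', t'). s \<le> s' \<and> s' - s \<le> t' - t}"
  define R2 where "R2 = kite \<inter> {(s', t'). t' \<le> t \<and> s' - s \<le> t' - t}"
  define R3 where "R3 = kite \<inter> {(s', t'). s \<le> s' \<and> t' \<le> t}"
  have [measurable]: "R1 \<in> sets borel" "R2 \<in> sets borel" "R3 \<in> sets borel"
    unfolding R1_def R2_def R3_def
    by (intro sets.Int kite_measurable sets_borel_Collect_pair; measurable)+
  define v1 where "v1 = (1 - s) * (1 - t) - (1 - s)\<^sup>2 / 2 - pos_sq (1 / 2 - s) + pos_sq (t - s) / 2"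
  define v2 where "v2 = (s - t / 2)\<^sup>2 - 3 / 2 * pos_sq (s - t)"
  define v3 where "v3 = (t - s / 2)\<^sup>2 - pos_sq (t - 1 / 2)"
  have a1: "emeasure lborel R1 = ennreal v1 \<and> 0 \<le> v1"
  proof (rule area_between_graphs[where a = s and b = 1
        and \<alpha> = "\<lambda>x. t + x - s" and \<beta> = "\<lambda>x. min 1 (2 * x)"
        and f = "\<lambda>x. 1 - t + s - x - 2 * max 0 (1 / 2 - x) + max 0 (x - 1 + t - s)"
        and F = "\<lambda>x. x * (1 - t + s) - x\<^sup>2 / 2 + pos_sq (1 / 2 - x) + pos_sq (x - 1 + t - s) / 2"])
    show "1 * (1 - t + s) - 1\<^sup>2 / 2 + pos_sq (1 / 2 - 1) + pos_sq (1 - 1 + t - s) / 2 -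
      (s * (1 - t + s) - s\<^sup>2 / 2 + pos_sq (1 / 2 - s) + pos_sq (s - 1 + t - s) / 2) = v1"
      using st by (simp add: v1_def pos_sq_simps power2_eq_square field_simps)
  qed (use st in \<open>auto intro!: derivative_eq_intros simp: R1_def kite_def max_def min_def add_divide_distrib diff_divide_distrib\<close>)
  have "{(t', s'). (s', t') \<in> R2} \<in> sets borel"
    by (intro sets_borel_Collect_pair) measurable
  then have "emeasure lborel {(t', s'). (s', t') \<in> R2} = (\<integral>\<^sup>+z. indicator {(t', s'). (s', t') \<in> R2} z \<partial>lborel)"
    by simp
  also have "\<dots> = (\<integral>\<^sup>+(t', s'). indicator R2 (s', t') \<partial>lborel)"
    by (intro nn_integral_cong) (auto simp: indicator_def)
  also have "\<dots> = emeasure lborel R2"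
    by (simp add: nn_integral_lborel_swap)
  finally have "emeasure lborel R2 = emeasure lborel {(t', s'). (s', t') \<in> R2}" ..
  moreover have "emeasure lborel {(t', s'). (s', t') \<in> R2} = ennreal v2 \<and> 0 \<le> v2"
  proof (rule area_between_graphs[where a = 0 and b = t
        and \<alpha> = "\<lambda>x. x / 2" and \<beta> = "\<lambda>x. min (2 * x) (x + s - t)"
        and f = "\<lambda>x. max 0 (x / 2 + s - t) - max 0 (s - t - x)"
        and F = "\<lambda>x. pos_sq (x / 2 + s - t) + pos_sq (s - t - x) / 2"])
    show "pos_sq (t / 2 + s - t) + pos_sq (s - t - t) / 2 - (pos_sq (0 / 2 + s - t) + pos_sq (s - t - 0) / 2) = v2"
      using st by (simp add: v2_def pos_sq_simps power2_eq_square field_simps)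
  qed (use st in \<open>auto intro!: derivative_eq_intros simp: R2_def kite_def max_def min_def add_divide_distrib diff_divide_distrib\<close>)
  ultimately have a2: "emeasure lborel R2 = ennreal v2 \<and> 0 \<le> v2"
    by simp
  have a3: "emeasure lborel R3 = ennreal v3 \<and> 0 \<le> v3"
  proof (rule area_between_graphs[where a = s and b = 1
        and \<alpha> = "\<lambda>x. x / 2" and \<beta> = "\<lambda>x. t"
        and f = "\<lambda>x. max 0 (t - x / 2)" and F = "\<lambda>x. - pos_sq (t - x / 2)"])
    show "- pos_sq (t - 1 / 2) - - pos_sq (t - s / 2) = v3"
      using st by (simp add: v3_def pos_sq_simps)
  qed (use st in \<open>auto intro!: derivative_eq_intros simp: R3_def kite_def max_def min_def\<close>)
  let ?B = "{b. kite_die s t \<succ> b}"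
  have [measurable]: "?B \<in> sets borel"
    by measurable
  have "emeasure balanced_die ?B = (\<integral>\<^sup>+b. indicator ?B b \<partial>balanced_die)"
    by (simp add: balanced_die_def)
  also have "\<dots> = 2 * (\<integral>\<^sup>+(s', t'). indicator ?B (kite_die s' t') * indicator kite (s', t') \<partial>lborel)"
    by (rule nn_integral_balanced_die) (simp_all add: indicator_def dominates_permute_die)
  also have "(\<integral>\<^sup>+(s', t'). indicator ?B (kite_die s' t') * indicator kite (s', t') \<partial>lborel) =
      (\<integral>\<^sup>+z. indicator R1 z + indicator R2 z + indicator R3 z \<partial>lborel)"
  proof (rule nn_integral_cong_AE)
    show "AE z in lborel. (case z of (s', t') \<Rightarrow> indicator ?B (kite_die s' t') * indicator kite (s', t')) =
        (indicator R1 z + indicator R2 z + indicator R3 z :: ennreal)"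
      using AE_kite_die_comparison[of s t]
    proof eventually_elim
      case (elim z)
      obtain s' t' where z: "z = (s', t')"
        by (cases z)
      have ne: "s' \<noteq> s" "t' \<noteq> t" "s' - s \<noteq> t' - t"
        using elim z by auto
      show ?case
      proof (cases "(s', t') \<in> kite")
        case True
        show ?thesis
          using dominates_kite_die[OF K True ne] True ne
          unfolding z R1_def R2_def R3_def by (auto simp: indicator_def)
      next
        case False
        then show ?thesis
          unfolding z R1_def R2_def R3_def by simp
      qed
    qed
  qed
  also have "\<dots> = ennreal (v1 + v2 + v3)"
    using a1 a2 a3 by (simp add: nn_integral_add)
  finally have "emeasure balanced_die ?B = 2 * ennreal (v1 + v2 + v3)" .
  moreover have w: "win_prob s t = 2 * (v1 + v2 + v3)"
  proof -
    have "pos_sq (t - s) = (s - t)\<^sup>2 - pos_sq (s - t)"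
      by (simp add: pos_sq_def max_def power2_commute)
    then show ?thesis
      unfolding v1_def v2_def v3_def win_prob_def
      by (simp add: power2_eq_square algebra_simps add_divide_distrib diff_divide_distrib)
  qed
  moreover show "0 \<le> win_prob s t"
    using a1 a2 a3 w by simp
  moreover have "ennreal (2 * x) = 2 * ennreal x" for x
    by (simp add: ennreal_mult')
  ultimately show "emeasure balanced_die ?B = ennreal (win_prob s t)"
    by (simp only: w)
qed

text \<open>
  Exchanging s and t replaces each face x by 1 - x and hence reverses every
  comparison.
\<close>

lemma win_prob_swap:
  "win_prob t s = 1 - win_prob s t"
proof -
  have *: "pos_sq (- x) = x\<^sup>2 - pos_sq x" for x
    by (simp add: pos_sq_def max_def)
  show ?thesis
    using *[of "s - t"] *[of "s - 1 / 2"] *[of "t - 1 / 2"]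
    by (simp add: win_prob_def power2_eq_square algebra_simps add_divide_distrib diff_divide_distrib)
qed

section \<open>The second moment of the winning probability\<close>

text \<open>
  The fundamental theorem of calculus twice: G is an antiderivative in the second
  variable, J the resulting function of the first variable, Q its antiderivative.
\<close>

lemma nn_integral_between_graphs:
  fixes g G :: "real \<Rightarrow> real \<Rightarrow> real" and \<alpha> \<beta> J Q :: "real \<Rightarrow> real"
  assumes [measurable]: "\<alpha> \<in> borel_measurable borel" "\<beta> \<in> borel_measurable borel" "J \<in> borel_measurable borel"
      "(\<lambda>z. g (fst z) (snd z)) \<in> borel_measurable borel"
    and A: "\<And>x y. (x, y) \<in> A \<longleftrightarrow> x \<in> {a..b} \<and> \<alpha> x \<le> y \<and> y \<le> \<beta> x"
    and "a \<le> b" and \<alpha>\<beta>: "\<And>x. a \<le> x \<Longrightarrow> x \<le> b \<Longrightarrow> \<alpha> x \<le> \<beta> x"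
    and G: "\<And>x y. (x, y) \<in> A \<Longrightarrow> (G x has_real_derivative g x y) (at y)"
    and g: "\<And>x y. (x, y) \<in> A \<Longrightarrow> 0 \<le> g x y"
    and J: "\<And>x. a \<le> x \<Longrightarrow> x \<le> b \<Longrightarrow> G x (\<beta> x) - G x (\<alpha> x) = J x"
    and Q: "\<And>x. a \<le> x \<Longrightarrow> x \<le> b \<Longrightarrow> (Q has_real_derivative J x) (at x)"
    and v: "Q b - Q a = v"
  shows "(\<integral>\<^sup>+(x, y). ennreal (g x y) * indicator A (x, y) \<partial>lborel) = ennreal v"
proof -
  have "A = {(x, y). x \<in> {a..b} \<and> \<alpha> x \<le> y \<and> y \<le> \<beta> x}"
    using A by auto
  then have [measurable]: "A \<in> sets borel"
    by (simp only:) (intro sets_borel_Collect_pair, measurable)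
  have "(\<integral>\<^sup>+(x, y). ennreal (g x y) * indicator A (x, y) \<partial>lborel) =
      (\<integral>\<^sup>+x. \<integral>\<^sup>+y. ennreal (g x y) * indicator A (x, y) \<partial>lborel \<partial>lborel)"
    by (subst nn_integral_lborel_pair(1)) (simp_all add: split_beta')
  also have "\<dots> = (\<integral>\<^sup>+x. ennreal (J x) * indicator {a..b} x \<partial>lborel)"
  proof (intro nn_integral_cong)
    fix x :: real
    show "(\<integral>\<^sup>+y. ennreal (g x y) * indicator A (x, y) \<partial>lborel) = ennreal (J x) * indicator {a..b} x"
    proof (cases "x \<in> {a..b}")
      case True
      have [measurable]: "g x \<in> borel_measurable borel"
      proof -
        have "(\<lambda>y :: real. (x, y)) \<in> borel_measurable borel"
          by (rule borel_measurable_Pair) simp_all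
        from measurable_compose[OF this assms(4)] show ?thesis by simp
      qed
      have "(\<integral>\<^sup>+y. ennreal (g x y) * indicator A (x, y) \<partial>lborel) =
          (\<integral>\<^sup>+y. ennreal (g x y) * indicator {\<alpha> x..\<beta> x} y \<partial>lborel)"
        using True by (intro nn_integral_cong) (auto simp: A indicator_def)
      also have "\<dots> = ennreal (G x (\<beta> x) - G x (\<alpha> x))"
        using True G g \<alpha>\<beta> by (intro nn_integral_FTC_Icc) (auto simp: A)
      finally show ?thesis
        using True J by simp
    next
      case False
      then have "indicator A (x, y) = (0 :: ennreal)" for y
        by (auto simp: A indicator_def)
      with False show ?thesis
        by simp
    qed
  qed
  also have "\<dots> = ennreal v"
  proof -
    have "0 \<le> J x" if "a \<le> x" "x \<le> b" for x
    proof -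
      have "G x (\<alpha> x) \<le> G x (\<beta> x)"
        using that \<alpha>\<beta> G g by (intro DERIV_nonneg_imp_nondecreasing[of "\<alpha> x" "\<beta> x" "G x"]) (auto simp: A intro!: exI)
      then show ?thesis
        using J[of x] that by simp
    qed
    then show ?thesis
      using Q \<open>a \<le> b\<close> unfolding v[symmetric] by (intro nn_integral_FTC_Icc) auto
  qed
  finally show ?thesis .
qed

lemma win_prob_measurable [measurable]:
  "(\<lambda>z. win_prob (fst z) (snd z)) \<in> borel_measurable borel"
  unfolding win_prob_def pos_sq_def by measurable

text \<open>
  By the symmetry of the kite, with p(t, s) = 1 - p(s, t), the integral of p^2 over the
  kite is the integral of p^2 + (1 - p)^2 = 1/2 + 2 (p - 1/2)^2 over the half t \<le> s.
  There p is a polynomial on each of the three pieces cut out by s = 1/2 and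
  t = 1/2, and the three integrals are elementary.
\<close>

lemma nn_integral_win_prob_squared:
  "(\<integral>\<^sup>+(s, t). ennreal ((win_prob s t)\<^sup>2) * indicator kite (s, t) \<partial>lborel) = ennreal (973 / 7680)"
proof -
  define A1 where "A1 = {(s, t). 0 \<le> s \<and> s \<le> 1 / 2 \<and> s / 2 \<le> t \<and> t \<le> (s::real)}"
  define A2 where "A2 = {(s, t). 1 / 2 \<le> s \<and> s \<le> 1 \<and> s / 2 \<le> t \<and> t \<le> (1 / 2::real)}"
  define A3 where "A3 = {(s, t). 1 / 2 \<le> s \<and> s \<le> 1 \<and> 1 / 2 \<le> t \<and> t \<le> (s::real)}"
  have [measurable]: "A1 \<in> sets borel" "A2 \<in> sets borel" "A3 \<in> sets borel"
    unfolding A1_def A2_def A3_def by (intro sets_borel_Collect_pair; measurable)+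
  define g1 where "g1 s t = 1 / 2 + 2 * ((s - t) * (4 - 7 * s + t) / 2)\<^sup>2" for s t :: real
  define g2 where "g2 s t = 1 / 2 + 2 * (1 / 2 - 2 * t + 4 * s * t - 3 / 2 * s\<^sup>2 - t\<^sup>2 / 2)\<^sup>2" for s t :: real
  define g3 where "g3 s t = 1 / 2 + 2 * ((s - t) * (5 * t - 3 * s) / 2)\<^sup>2" for s t :: real
  define G where "G s t = (win_prob s t)\<^sup>2 + (win_prob t s)\<^sup>2" for s t
  have G: "G s t = 1 / 2 + 2 * (win_prob s t - 1 / 2)\<^sup>2" for s t
    unfolding G_def win_prob_swap[of s t] by (simp add: power2_eq_square algebra_simps)
  have G1: "G s t = g1 s t" if "(s, t) \<in> A1" for s t
  proof -
    have "win_prob s t - 1 / 2 = (s - t) * (4 - 7 * s + t) / 2"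
      using that by (simp add: A1_def win_prob_def pos_sq_simps power2_eq_square field_simps)
    then show ?thesis by (simp only: G g1_def)
  qed
  have G2: "G s t = g2 s t" if "(s, t) \<in> A2" for s t
  proof -
    have "win_prob s t - 1 / 2 = 1 / 2 - 2 * t + 4 * s * t - 3 / 2 * s\<^sup>2 - t\<^sup>2 / 2"
      using that by (simp add: A2_def win_prob_def pos_sq_simps power2_eq_square field_simps)
    then show ?thesis by (simp only: G g2_def)
  qed
  have G3: "G s t = g3 s t" if "(s, t) \<in> A3" for s t
  proof -
    have "win_prob s t - 1 / 2 = (s - t) * (5 * t - 3 * s) / 2"
      using that by (simp add: A3_def win_prob_def pos_sq_simps power2_eq_square field_simps)
    then show ?thesis by (simp only: G g3_def)
  qed
  have I1: "(\<integral>\<^sup>+(s, t). ennreal (g1 s t) * indicator A1 (s, t) \<partial>lborel) = ennreal (787 / 24576)"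
  proof (rule nn_integral_between_graphs[where \<alpha> = "\<lambda>s. s / 2" and \<beta> = "\<lambda>s. s" and a = 0 and b = "1 / 2"
      and G = "\<lambda>s t. t / 2 + 8 / 3 * t ^ 3 + t ^ 4 + t ^ 5 / 10 - 8 * s * t ^ 2 - 12 * s * t ^ 3 - 2 * s * t ^ 4
        + 8 * s ^ 2 * t + 30 * s ^ 2 * t ^ 2 + 13 * s ^ 2 * t ^ 3 - 28 * s ^ 3 * t - 28 * s ^ 3 * t ^ 2 + 49 / 2 * s ^ 4 * t"
      and J = "\<lambda>s. s / 4 + s ^ 3 / 3 - 17 / 16 * s ^ 4 + 271 / 320 * s ^ 5"
      and Q = "\<lambda>s. s ^ 2 / 8 + s ^ 4 / 12 - 17 / 80 * s ^ 5 + 271 / 1920 * s ^ 6"])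
    show "0 \<le> g1 x y" for x y
      by (simp add: g1_def)
  qed (auto intro!: derivative_eq_intros simp: A1_def g1_def field_simps eval_nat_numeral)
  have I2: "(\<integral>\<^sup>+(s, t). ennreal (g2 s t) * indicator A2 (s, t) \<partial>lborel) = ennreal (11603 / 368640)"
  proof (rule nn_integral_between_graphs[where \<alpha> = "\<lambda>s. s / 2" and \<beta> = "\<lambda>s. 1 / 2" and a = "1 / 2" and b = 1
      and G = "\<lambda>s t. t - 2 * t ^ 2 + 7 / 3 * t ^ 3 + t ^ 4 + t ^ 5 / 10 + 4 * s * t ^ 2 - 32 / 3 * s * t ^ 3 - 2 * s * t ^ 4
        - 3 * s ^ 2 * t + 6 * s ^ 2 * t ^ 2 + 35 / 3 * s ^ 2 * t ^ 3 - 12 * s ^ 3 * t ^ 2 + 9 / 2 * s ^ 4 * t"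
      and J = "\<lambda>s. 343 / 960 - 23 / 24 * s + 47 / 24 * s ^ 2 - 67 / 24 * s ^ 3 + 97 / 48 * s ^ 4 - 563 / 960 * s ^ 5"
      and Q = "\<lambda>s. 343 / 960 * s - 23 / 48 * s ^ 2 + 47 / 72 * s ^ 3 - 67 / 96 * s ^ 4 + 97 / 240 * s ^ 5 - 563 / 5760 * s ^ 6"])
    show "0 \<le> g2 x y" for x y
      by (simp add: g2_def)
  qed (auto intro!: derivative_eq_intros simp: A2_def g2_def field_simps eval_nat_numeral)
  have I3: "(\<integral>\<^sup>+(s, t). ennreal (g3 s t) * indicator A3 (s, t) \<partial>lborel) = ennreal (91 / 1440)"
  proof (rule nn_integral_between_graphs[where \<alpha> = "\<lambda>s. 1 / 2" and \<beta> = "\<lambda>s. s" and a = "1 / 2" and b = 1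
      and G = "\<lambda>s t. t / 2 + 5 / 2 * t ^ 5 - 10 * s * t ^ 4 + 47 / 3 * s ^ 2 * t ^ 3 - 12 * s ^ 3 * t ^ 2 + 9 / 2 * s ^ 4 * t"
      and J = "\<lambda>s. - 21 / 64 + 9 / 8 * s - 47 / 24 * s ^ 2 + 3 * s ^ 3 - 9 / 4 * s ^ 4 + 2 / 3 * s ^ 5"
      and Q = "\<lambda>s. - 21 / 64 * s + 9 / 16 * s ^ 2 - 47 / 72 * s ^ 3 + 3 / 4 * s ^ 4 - 9 / 20 * s ^ 5 + s ^ 6 / 9"])
    show "0 \<le> g3 x y" for x y
      by (simp add: g3_def)
  qed (auto intro!: derivative_eq_intros simp: A3_def g3_def field_simps eval_nat_numeral)
  \<comment> \<open>The half t \<le> s of the kite; there t \<le> 1 and t \<le> 2 s follow.\<close>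
  define T where "T = {(s, t). s \<le> 1 \<and> t \<le> s \<and> s \<le> 2 * (t::real)}"
  have [measurable]: "T \<in> sets borel"
    unfolding T_def by (intro sets_borel_Collect_pair) measurable
  have [measurable]: "(\<lambda>z. win_prob (snd z) (fst z)) \<in> borel_measurable borel"
    unfolding win_prob_def pos_sq_def by measurable
  have ae1: "AE (s, t) in lborel. s \<noteq> (t::real)"
    using AE_lborel_off_line[of 1 "-1" 0] by (simp add: case_prod_beta)
  have "(\<integral>\<^sup>+(s, t). ennreal ((win_prob s t)\<^sup>2) * indicator kite (s, t) \<partial>lborel) =
      (\<integral>\<^sup>+z. (case z of (s, t) \<Rightarrow> ennreal ((win_prob s t)\<^sup>2) * indicator T (s, t))
        + (case z of (s, t) \<Rightarrow> ennreal ((win_prob s t)\<^sup>2) * indicator T (t, s)) \<partial>lborel)"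
    by (intro nn_integral_cong_AE eventually_mono[OF ae1]) (auto simp: T_def kite_def indicator_def)
  also have "\<dots> = (\<integral>\<^sup>+(s, t). ennreal ((win_prob s t)\<^sup>2) * indicator T (s, t) \<partial>lborel)
      + (\<integral>\<^sup>+(s, t). ennreal ((win_prob s t)\<^sup>2) * indicator T (t, s) \<partial>lborel)"
    by (simp add: nn_integral_add split_beta')
  also have "(\<integral>\<^sup>+(s, t). ennreal ((win_prob s t)\<^sup>2) * indicator T (t, s) \<partial>lborel) =
      (\<integral>\<^sup>+(s, t). ennreal ((win_prob t s)\<^sup>2) * indicator T (s, t) \<partial>lborel)"
    using nn_integral_lborel_swap[of "\<lambda>(s, t). ennreal ((win_prob t s)\<^sup>2) * indicator T (s, t)"]
    by (simp add: split_beta')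
  also have "(\<integral>\<^sup>+(s, t). ennreal ((win_prob s t)\<^sup>2) * indicator T (s, t) \<partial>lborel) + \<dots> =
      (\<integral>\<^sup>+(s, t). ennreal (G s t) * indicator T (s, t) \<partial>lborel)"
    unfolding G_def by (simp add: split_beta' distrib_right flip: nn_integral_add)
  also have "\<dots> = (\<integral>\<^sup>+z. (case z of (s, t) \<Rightarrow> ennreal (g1 s t) * indicator A1 (s, t))
        + (case z of (s, t) \<Rightarrow> ennreal (g2 s t) * indicator A2 (s, t))
        + (case z of (s, t) \<Rightarrow> ennreal (g3 s t) * indicator A3 (s, t)) \<partial>lborel)"
  proof (intro nn_integral_cong_AE)
    have ae2: "AE (s, t) in lborel. 1 * s + 0 * t \<noteq> (1 / 2 :: real)"
      and ae3: "AE (s, t) in lborel. 0 * s + 1 * t \<noteq> (1 / 2 :: real)"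
      by (rule AE_lborel_off_line; simp)+
    show "AE z in lborel. (case z of (s, t) \<Rightarrow> ennreal (G s t) * indicator T (s, t)) =
      (case z of (s, t) \<Rightarrow> ennreal (g1 s t) * indicator A1 (s, t))
        + (case z of (s, t) \<Rightarrow> ennreal (g2 s t) * indicator A2 (s, t))
        + (case z of (s, t) \<Rightarrow> ennreal (g3 s t) * indicator A3 (s, t))"
      using ae2 ae3
    proof eventually_elim
      case (elim z)
      obtain s t where z: "z = (s, t)"
        by (cases z)
      have "indicator T (s, t) = (indicator A1 (s, t) + indicator A2 (s, t) + indicator A3 (s, t) :: ennreal)"
        using elim by (auto simp: z T_def A1_def A2_def A3_def indicator_def)
      then show ?case
        using G1[of s t] G2[of s t] G3[of s t] by (auto simp: z indicator_def distrib_left)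
    qed
  qed
  also have "\<dots> = ennreal (787 / 24576) + ennreal (11603 / 368640) + ennreal (91 / 1440)"
    unfolding I1[symmetric] I2[symmetric] I3[symmetric]
    by (subst nn_integral_add; simp add: split_beta' g1_def g2_def g3_def)+
  also have "\<dots> = ennreal (973 / 7680)"
    by (simp flip: ennreal_plus)
  finally show ?thesis .
qed

section \<open>Comparisons of independent dice\<close>

lemma sets_balanced_die [simp, measurable_cong]: "sets balanced_die = sets borel"
  and space_balanced_die [simp]: "space balanced_die = UNIV"
  by (simp_all add: balanced_die_def)

lemma prob_space_balanced_die: "prob_space balanced_die"
proof
  have "emeasure balanced_die (space balanced_die) = (\<integral>\<^sup>+a. 1 \<partial>balanced_die)"
    by simp
  also have "\<dots> = 2 * (\<integral>\<^sup>+(s, t). 1 * indicator kite (s, t) \<partial>lborel)"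
    by (rule nn_integral_balanced_die) simp_all
  also have "(\<integral>\<^sup>+(s, t). 1 * indicator kite (s, t) \<partial>lborel) = ennreal (1 / 2)"
    by (simp add: emeasure_kite case_prod_unfold del: ennreal_half)
  also have "2 * ennreal (1 / 2) = 1"
    by (simp del: ennreal_half flip: ennreal_numeral ennreal_mult)
  finally show "emeasure balanced_die (space balanced_die) = 1" .
qed

lemma ex_3_iff: "(\<exists>i :: 3. P i) \<longleftrightarrow> P 1 \<or> P 2 \<or> P 3"
  using forall_3[of "\<lambda>i. \<not> P i"] by blast

text \<open>
  In the kite parametrization each face is a nonconstant affine function of (s, t).
\<close>

lemma AE_balanced_die_nth_neq: "AE b in balanced_die. \<forall>j. b $ j \<noteq> c"
proof -
  let ?N = "{b :: real ^ 3. \<exists>j. b $ j = c}"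
  have [measurable]: "?N \<in> sets borel"
    unfolding ex_3_iff by measurable
  have "emeasure balanced_die ?N = (\<integral>\<^sup>+b. indicator ?N b \<partial>balanced_die)"
    by simp
  also have "\<dots> = 2 * (\<integral>\<^sup>+(s, t). indicator ?N (kite_die s t) * indicator kite (s, t) \<partial>lborel)"
    by (rule nn_integral_balanced_die) (auto simp: indicator_def ex_3_iff)
  also have "(\<integral>\<^sup>+(s, t). indicator ?N (kite_die s t) * indicator kite (s, t) \<partial>lborel) = (\<integral>\<^sup>+z. 0 \<partial>(lborel :: (real \<times> real) measure))"
  proof (rule nn_integral_cong_AE)
    have "AE (s, t) in lborel. 1 * s + 0 * t \<noteq> 1 - 2 * c" "AE (s, t) in lborel. 1 * s + (-1) * t \<noteq> 2 * c - 1"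
      "AE (s, t) in lborel. 0 * s + 1 * t \<noteq> 2 * c - 1"
      by (rule AE_lborel_off_line, simp)+
    then show "AE z in lborel. (case z of (s, t) \<Rightarrow> indicator ?N (kite_die s t) * indicator kite (s, t)) = (0 :: ennreal)"
      by eventually_elim (auto simp: kite_die_def ex_3_iff indicator_def field_simps)
  qed
  finally have "emeasure balanced_die ?N = 0"
    by simp
  then have "AE b in balanced_die. b \<notin> ?N"
    by (intro AE_not_in) (simp add: null_sets_def)
  then show ?thesis
    by simp
qed

text \<open>
  Without ties all nine signs are odd integers, and so is their sum.
\<close>

lemma dominates_total:
  assumes "\<And>i j. a $ i \<noteq> b $ j"
  shows "a \<succ> b \<or> b \<succ> a"
proof -
  define n :: "3 \<Rightarrow> 3 \<Rightarrow> int" where "n i j = (if b $ j < a $ i then 1 else - 1)" for i j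
  have "sgn (a $ i - b $ j) = of_int (n i j)" "sgn (b $ j - a $ i) = - of_int (n i j)" for i j
    using assms[of i j] by (auto simp: n_def)
  then have "a \<succ> b \<longleftrightarrow> 0 < (of_int (\<Sum>i\<in>UNIV. \<Sum>j\<in>UNIV. n i j) :: real)"
    "b \<succ> a \<longleftrightarrow> (of_int (\<Sum>i\<in>UNIV. \<Sum>j\<in>UNIV. n i j) :: real) < 0"
    unfolding dominates_def by (simp_all add: sum_3) linarith
  moreover have "odd (n i j)" for i j
    by (simp add: n_def)
  then have "odd (\<Sum>i\<in>UNIV. \<Sum>j\<in>UNIV. n i j)"
    by (simp add: sum_3)
  then have "(\<Sum>i\<in>UNIV. \<Sum>j\<in>UNIV. n i j) \<noteq> 0"
    by (metis even_zero)
  ultimately show ?thesis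
    by (simp only: of_int_0_less_iff of_int_less_0_iff) linarith
qed

lemma AE_dominates_total: "AE b in balanced_die. a \<succ> b \<or> b \<succ> a"
proof -
  have "AE b in balanced_die. b $ j \<noteq> a $ 1 \<and> b $ j \<noteq> a $ 2 \<and> b $ j \<noteq> a $ 3" for j
    using AE_balanced_die_nth_neq[of "a $ 1"] AE_balanced_die_nth_neq[of "a $ 2"] AE_balanced_die_nth_neq[of "a $ 3"]
    by eventually_elim simp
  from this[of 1] this[of 2] this[of 3] show ?thesis
  proof eventually_elim
    case (elim b)
    then have "\<forall>i j. a $ i \<noteq> b $ j"
      by (auto simp: forall_3)
    then show ?case
      using dominates_total by blast
  qed
qed

lemma emeasure_beaten_eq_nn_integral:
  "emeasure balanced_die {b. a \<succ> b} = (\<integral>\<^sup>+b. of_bool (a \<succ> b) \<partial>balanced_die)"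
proof -
  have "emeasure balanced_die {b. a \<succ> b} = (\<integral>\<^sup>+b. indicator {b. a \<succ> b} b \<partial>balanced_die)"
    by (rule nn_integral_indicator[symmetric]) simp
  then show ?thesis
    by (simp add: indicator_def)
qed

lemma of_bool_dominates_measurable [measurable (raw)]:
  assumes [measurable]: "f \<in> borel_measurable M" "g \<in> borel_measurable M"
  shows "(\<lambda>x. of_bool (f x \<succ> g x) :: ennreal) \<in> borel_measurable M"
  unfolding of_bool_def by measurable

text \<open>
  This integral is the probability that one die beats two independent others, since
  given the first die the two events are independent with equal probability.
\<close>

lemma nn_integral_beaten_squared:
  "(\<integral>\<^sup>+a. (emeasure balanced_die {b. a \<succ> b})\<^sup>2 \<partial>balanced_die) = ennreal (973 / 3840)"
proof -
  interpret D: prob_space balanced_die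
    by (rule prob_space_balanced_die)
  have "(\<integral>\<^sup>+a. (emeasure balanced_die {b. a \<succ> b})\<^sup>2 \<partial>balanced_die) =
      2 * (\<integral>\<^sup>+(s, t). (emeasure balanced_die {b. kite_die s t \<succ> b})\<^sup>2 * indicator kite (s, t) \<partial>lborel)"
  proof (rule nn_integral_balanced_die)
    show "(\<lambda>a. (emeasure balanced_die {b. a \<succ> b})\<^sup>2) \<in> borel_measurable borel"
      unfolding emeasure_beaten_eq_nn_integral by measurable
  qed (simp_all add: dominates_permute_die)
  also have "(\<integral>\<^sup>+(s, t). (emeasure balanced_die {b. kite_die s t \<succ> b})\<^sup>2 * indicator kite (s, t) \<partial>lborel) =
      (\<integral>\<^sup>+(s, t). ennreal ((win_prob s t)\<^sup>2) * indicator kite (s, t) \<partial>lborel)"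
    by (intro nn_integral_cong)
      (auto simp: indicator_def emeasure_beaten ennreal_power)
  also have "2 * \<dots> = ennreal (973 / 3840)"
    unfolding nn_integral_win_prob_squared by (simp flip: ennreal_numeral ennreal_mult)
  finally show ?thesis .
qed

lemma nn_integral_PiM_three:
  fixes i j k :: nat and f :: "'a \<Rightarrow> 'a \<Rightarrow> 'a \<Rightarrow> ennreal"
  assumes "sigma_finite_measure N" and ijk: "distinct [i, j, k]"
    and f: "(\<lambda>(a, b, c). f a b c) \<in> borel_measurable (N \<Otimes>\<^sub>M N \<Otimes>\<^sub>M N)"
  shows "(\<integral>\<^sup>+x. f (x i) (x j) (x k) \<partial>Pi\<^sub>M {i, j, k} (\<lambda>_. N)) =
    (\<integral>\<^sup>+a. \<integral>\<^sup>+b. \<integral>\<^sup>+c. f a b c \<partial>N \<partial>N \<partial>N)"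
proof -
  interpret N: sigma_finite_measure N by fact
  interpret product_sigma_finite "\<lambda>_ :: nat. N" ..
  have [measurable]: "(\<lambda>x. f (\<alpha> x) (\<beta> x) (\<gamma> x)) \<in> borel_measurable L"
    if "\<alpha> \<in> L \<rightarrow>\<^sub>M N" "\<beta> \<in> L \<rightarrow>\<^sub>M N" "\<gamma> \<in> L \<rightarrow>\<^sub>M N" for \<alpha> \<beta> \<gamma> and L :: "'z measure"
    using measurable_compose[OF _ f, of "\<lambda>x. (\<alpha> x, \<beta> x, \<gamma> x)" L] that by simp
  have "(\<integral>\<^sup>+x. f (x i) (x j) (x k) \<partial>Pi\<^sub>M {i, j, k} (\<lambda>_. N)) =
      (\<integral>\<^sup>+a. \<integral>\<^sup>+x. f a (x j) (x k) \<partial>Pi\<^sub>M {j, k} (\<lambda>_. N) \<partial>N)"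
    using ijk by (subst product_nn_integral_insert_rev) auto
  also have "\<dots> = (\<integral>\<^sup>+a. \<integral>\<^sup>+b. \<integral>\<^sup>+x. f a b (x k) \<partial>Pi\<^sub>M {k} (\<lambda>_. N) \<partial>N \<partial>N)"
    using ijk by (intro nn_integral_cong, subst product_nn_integral_insert_rev) auto
  also have "\<dots> = (\<integral>\<^sup>+a. \<integral>\<^sup>+b. \<integral>\<^sup>+c. f a b c \<partial>N \<partial>N \<partial>N)"
    by (intro nn_integral_cong, subst product_nn_integral_singleton) auto
  finally show ?thesis .
qed

lemma emeasure_beats_both:
  fixes i j k :: nat
  assumes "distinct [i, j, k]"
  shows "emeasure (Pi\<^sub>M {i, j, k} (\<lambda>_. balanced_die))
      {x \<in> space (Pi\<^sub>M {i, j, k} (\<lambda>_. balanced_die)). x i \<succ> x j \<and> x i \<succ> x k} = ennreal (973 / 3840)"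
proof -
  interpret D: prob_space balanced_die
    by (rule prob_space_balanced_die)
  let ?P = "Pi\<^sub>M {i, j, k} (\<lambda>_. balanced_die)"
  let ?E = "{x \<in> space ?P. x i \<succ> x j \<and> x i \<succ> x k}"
  have "emeasure ?P ?E = (\<integral>\<^sup>+x. indicator ?E x \<partial>?P)"
    by (rule nn_integral_indicator[symmetric]) measurable
  also have "\<dots> = (\<integral>\<^sup>+x. of_bool (x i \<succ> x j) * of_bool (x i \<succ> x k) \<partial>?P)"
    by (intro nn_integral_cong) (simp add: indicator_def)
  also have "\<dots> = (\<integral>\<^sup>+a. \<integral>\<^sup>+b. \<integral>\<^sup>+c. of_bool (a \<succ> b) * of_bool (a \<succ> c) \<partial>balanced_die \<partial>balanced_die \<partial>balanced_die)"
    by (rule nn_integral_PiM_three[where f = "\<lambda>a b c. of_bool (a \<succ> b) * of_bool (a \<succ> c)"])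
      (use assms D.sigma_finite_measure_axioms in \<open>simp_all add: split_beta'\<close>)
  also have "\<dots> = (\<integral>\<^sup>+a. (emeasure balanced_die {b. a \<succ> b})\<^sup>2 \<partial>balanced_die)"
    unfolding emeasure_beaten_eq_nn_integral
    by (simp add: nn_integral_cmult nn_integral_multc power2_eq_square)
  finally show ?thesis
    by (simp add: nn_integral_beaten_squared)
qed

lemma AE_PiM_dominates_total:
  fixes i j k :: nat
  assumes "distinct [i, j, k]"
  shows "AE x in Pi\<^sub>M {i, j, k} (\<lambda>_. balanced_die). x i \<succ> x j \<or> x j \<succ> x i"
proof -
  interpret D: prob_space balanced_die
    by (rule prob_space_balanced_die)
  let ?P = "Pi\<^sub>M {i, j, k} (\<lambda>_. balanced_die)"
  \<comment> \<open>The indicator function of a draw between a and b.\<close>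
  define f :: "real ^ 3 \<Rightarrow> real ^ 3 \<Rightarrow> ennreal" where
    "f a b = (if a \<succ> b \<or> b \<succ> a then 0 else 1)" for a b
  have "(\<integral>\<^sup>+x. f (x i) (x j) \<partial>?P) = (\<integral>\<^sup>+a. \<integral>\<^sup>+b. \<integral>\<^sup>+c. f a b \<partial>balanced_die \<partial>balanced_die \<partial>balanced_die)"
    by (rule nn_integral_PiM_three[where f = "\<lambda>a b c. f a b"])
      (use assms D.sigma_finite_measure_axioms in \<open>simp_all add: split_beta' f_def\<close>)
  also have "\<dots> = (\<integral>\<^sup>+a. \<integral>\<^sup>+b. 0 \<partial>balanced_die \<partial>balanced_die)"
  proof (rule nn_integral_cong, rule nn_integral_cong_AE)
    show "AE b in balanced_die. (\<integral>\<^sup>+c. f a b \<partial>balanced_die) = 0" for a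
      using AE_dominates_total[of a] by eventually_elim (simp add: f_def)
  qed
  finally have "(\<integral>\<^sup>+x. f (x i) (x j) \<partial>?P) = 0"
    by simp
  then have "AE x in ?P. f (x i) (x j) = 0"
    by (subst (asm) nn_integral_0_iff_AE) (simp_all add: f_def)
  then show ?thesis
    by eventually_elim (simp add: f_def split: if_splits)
qed

section \<open>Transitive and intransitive triples\<close>

lemma transitive_chain_iff:
  "transitive_chain a b c \<longleftrightarrow>
     a \<succ> b \<and> b \<succ> c \<and> a \<succ> c \<or> a \<succ> c \<and> c \<succ> b \<and> a \<succ> b \<or>
     b \<succ> a \<and> a \<succ> c \<and> b \<succ> c \<or> b \<succ> c \<and> c \<succ> a \<and> b \<succ> a \<or>
     c \<succ> a \<and> a \<succ> b \<and> c \<succ> b \<or> c \<succ> b \<and> b \<succ> a \<and> c \<succ> a"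
proof -
  have "mset [x, y, z] = mset [a, b, c] \<longleftrightarrow>
      (x, y, z) \<in> {(a, b, c), (a, c, b), (b, a, c), (b, c, a), (c, a, b), (c, b, a)}" for x y z
    by (auto simp: add_eq_conv_ex)
  then show ?thesis
    unfolding transitive_chain_def by auto
qed

text \<open>
  In a tournament on three vertices a vertex that beats both others makes it transitive,
  whatever the third comparison.
\<close>

lemma transitive_chain_iff_beats_both:
  assumes "a \<succ> b \<or> b \<succ> a" "b \<succ> c \<or> c \<succ> b" "a \<succ> c \<or> c \<succ> a"
  shows "transitive_chain a b c \<longleftrightarrow> a \<succ> b \<and> a \<succ> c \<or> b \<succ> a \<and> b \<succ> c \<or> c \<succ> a \<and> c \<succ> b"
  using assms unfolding transitive_chain_iff by (auto dest: dominates_asym)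

lemma intransitive_triple_iff_not_transitive_chain:
  assumes "a \<succ> b \<or> b \<succ> a" "b \<succ> c \<or> c \<succ> b" "a \<succ> c \<or> c \<succ> a"
  shows "intransitive_triple a b c \<longleftrightarrow> \<not> transitive_chain a b c"
  using assms unfolding transitive_chain_iff intransitive_triple_def by (auto dest: dominates_asym)

theorem theorem5:
  fixes M :: "'w measure" and A B C :: "'w \<Rightarrow> real ^ 3"
  assumes "prob_space M"
    and "prob_space.indep_vars M (\<lambda>_. borel) (\<lambda>i::nat. [A, B, C] ! i) {0, 1, 2}"
    and "distr M borel A = balanced_die"
    and "distr M borel B = balanced_die"
    and "distr M borel C = balanced_die"
  shows "measure M {w \<in> space M. intransitive_triple (A w) (B w) (C w)} = 307 / 1280 \<and>
         measure M {w \<in> space M. transitive_chain (A w) (B w) (C w)} = 973 / 1280"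
proof -
  interpret prob_space M by fact
  define X where "X i = [A, B, C] ! i" for i :: nat
  have X [simp]: "X 0 = A" "X 1 = B" "X (Suc 0) = B" "X 2 = C"
    by (simp_all add: X_def numeral_2_eq_2)
  define I :: "nat set" where "I = {0, 1, 2}"
  have indep: "indep_vars (\<lambda>_. borel) X I"
    using assms(2) unfolding X_def I_def .
  have rv [measurable]: "X i \<in> borel_measurable M" if "i \<in> I" for i
    using indep that by (auto simp: indep_vars_def)
  have [measurable]: "A \<in> borel_measurable M" "B \<in> borel_measurable M" "C \<in> borel_measurable M"
    using rv[of 0] rv[of 1] rv[of 2] by (simp_all add: I_def)
  have D: "distr M borel (X i) = balanced_die" if "i \<in> I" for i
    using that assms(3-5) by (auto simp: I_def)
  have joint: "distr M (Pi\<^sub>M I (\<lambda>_. borel)) (\<lambda>w. \<lambda>i\<in>I. X i w) = Pi\<^sub>M I (\<lambda>_. balanced_die)"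
  proof -
    have "distr M (Pi\<^sub>M I (\<lambda>_. borel)) (\<lambda>w. \<lambda>i\<in>I. X i w) = Pi\<^sub>M I (\<lambda>i. distr M borel (X i))"
      using indep rv by (subst (asm) indep_vars_iff_distr_eq_PiM') (auto simp: I_def)
    also have "\<dots> = Pi\<^sub>M I (\<lambda>_. balanced_die)"
      by (rule PiM_cong) (simp_all add: D)
    finally show ?thesis .
  qed
  have transfer: "AE w in M. P (\<lambda>i\<in>I. X i w)" if "AE x in Pi\<^sub>M I (\<lambda>_. balanced_die). P x" for P
    using that unfolding joint[symmetric] by (rule AE_distrD[rotated]) measurable
  have both: "prob {w \<in> space M. X i w \<succ> X j w \<and> X i w \<succ> X k w} = 973 / 3840"
    if "distinct [i, j, k]" "{i, j, k} = I" for i j k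
  proof -
    let ?P = "Pi\<^sub>M I (\<lambda>_. balanced_die)"
    let ?E = "{x \<in> space ?P. x i \<succ> x j \<and> x i \<succ> x k}"
    have mem: "i \<in> I" "j \<in> I" "k \<in> I"
      using that by auto
    have "?E \<in> sets ?P"
      using mem by measurable
    moreover have "sets ?P = sets (Pi\<^sub>M I (\<lambda>_. borel))"
      by (rule sets_PiM_cong) simp_all
    ultimately have "emeasure ?P ?E = emeasure M ((\<lambda>w. \<lambda>i\<in>I. X i w) -` ?E \<inter> space M)"
      unfolding joint[symmetric] by (intro emeasure_distr) (simp_all add: joint)
    also have "(\<lambda>w. \<lambda>i\<in>I. X i w) -` ?E \<inter> space M = {w \<in> space M. X i w \<succ> X j w \<and> X i w \<succ> X k w}"
      using mem by (auto simp: space_PiM)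
    finally show ?thesis
      using emeasure_beats_both[OF that(1)] that(2) by (simp add: measure_def)
  qed
  have total: "AE w in M. X i w \<succ> X j w \<or> X j w \<succ> X i w"
    if "distinct [i, j, k]" "{i, j, k} = I" for i j k
  proof -
    have mem: "i \<in> I" "j \<in> I"
      using that by auto
    have "AE x in Pi\<^sub>M I (\<lambda>_. balanced_die). x i \<succ> x j \<or> x j \<succ> x i"
      using AE_PiM_dominates_total[OF that(1)] unfolding that(2) .
    from transfer[OF this] mem show ?thesis
      by simp
  qed
  have t: "AE w in M. A w \<succ> B w \<or> B w \<succ> A w" "AE w in M. B w \<succ> C w \<or> C w \<succ> B w" "AE w in M. A w \<succ> C w \<or> C w \<succ> A w"
    using total[of 0 1 2] total[of 1 2 0] total[of 0 2 1] by (simp_all add: I_def insert_commute)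
  let ?T = "{w \<in> space M. transitive_chain (A w) (B w) (C w)}"
  let ?EA = "{w \<in> space M. A w \<succ> B w \<and> A w \<succ> C w}"
  let ?EB = "{w \<in> space M. B w \<succ> A w \<and> B w \<succ> C w}"
  let ?EC = "{w \<in> space M. C w \<succ> A w \<and> C w \<succ> B w}"
  have [measurable]: "?T \<in> events"
    unfolding transitive_chain_iff by measurable
  have "prob ?T = prob (?EA \<union> ?EB \<union> ?EC)"
  proof (rule measure_eq_AE)
    show "AE w in M. w \<in> ?T \<longleftrightarrow> w \<in> ?EA \<union> ?EB \<union> ?EC"
      using t by eventually_elim (auto simp: transitive_chain_iff_beats_both)
  qed measurable
  also have "\<dots> = prob ?EA + prob ?EB + prob ?EC"
  proof -
    have "prob (?EA \<union> ?EB \<union> ?EC) = prob (?EA \<union> ?EB) + prob ?EC"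
      by (rule finite_measure_Union) (auto dest: dominates_asym)
    also have "prob (?EA \<union> ?EB) = prob ?EA + prob ?EB"
      by (rule finite_measure_Union) (auto dest: dominates_asym)
    finally show ?thesis .
  qed
  also have "\<dots> = 973 / 1280"
    using both[of 0 1 2] both[of 1 0 2] both[of 2 0 1] by (simp add: I_def insert_commute)
  finally have T: "prob ?T = 973 / 1280" .
  have "prob {w \<in> space M. intransitive_triple (A w) (B w) (C w)} = prob (space M - ?T)"
  proof (rule measure_eq_AE)
    show "AE w in M. w \<in> {w \<in> space M. intransitive_triple (A w) (B w) (C w)} \<longleftrightarrow> w \<in> space M - ?T"
      using t by eventually_elim (auto simp: intransitive_triple_iff_not_transitive_chain)
    show "{w \<in> space M. intransitive_triple (A w) (B w) (C w)} \<in> events"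
      unfolding intransitive_triple_def by measurable
  qed measurable
  also have "\<dots> = 1 - 973 / 1280"
    using T by (simp add: prob_compl)
  finally show ?thesis
    using T by simp
qed

end
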